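(* Let $n$ be a composite positive integer with prime factorization $n=p_1^{\alpha_1}\cdots p_k^{\alpha_k}$, where $p_1<p_2<\cdots<p_k$ are primes and $\alpha_i\ge 1$. Let $D_n$ be the set of divisors $d$ of $n$ with $1\le d<n$, and let $\overline{D}_{p_1}=\{d\in D_n : p_1\nmid d\}$. Let $D\subseteq D_n$ be such that $D\ne\overline{D}_{p_1}$ and the integral circulant graph $\mathrm{ICG}_n(D)$ is connected. Then for every $1\le j\le n$, $$\lambda_j(n,D)\ \ge\ \begin{cases}-\dfrac{n}{p_1}+p_1-1, & \alpha_1>1,\\[2mm] -\dfrac{n}{p_1}+1, & \alpha_1=1.\end{cases}$$ Equality is achieved under the following conditions: (i) when $\alpha_1>1$, $D=\overline{D}_{p_1}\cup\left\{\frac{n}{p_1}\right\}$ and $\frac{n}{p_1}\mid j$, for $1\le j\le n-1$; (ii) when $\alpha_1=1$, $D=\overline{D}_{p_1}\setminus\left\{\frac{n}{p_1}\right\}$ and $\frac{n}{p_1}\mid j$, for $1\le j\le n-1$; (iii) for $n=6$, when $D=\{1\}$ and $j=3$, or $D=\{1,2\}$ and $j\in\{2,4\}$, or $D=\{2,3\}$ and $j\in\{1,5\}$.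
   Context: For $D\subseteq D_n$, the integral circulant graph $\mathrm{ICG}_n(D)$ has vertex set $\mathbb{Z}_n=\{0,1,\ldots,n-1\}$, with $a$ and $b$ adjacent if and only if $\gcd(a-b,n)\in D$. The eigenvalues of its adjacency matrix are indexed as $$\lambda_j(n,D)=\sum_{d\in D} c\left(j,\tfrac{n}{d}\right)$$ (with $0\le j\le n-1$; the same formula is used for $j=n$ and gives $\lambda_n=\lambda_0$), where, for a positive integer $m$ and an integer $j\ge 0$, $$c(j,m)=\mu(t_{m,j})\frac{\varphi(m)}{\varphi(t_{m,j})},\qquad t_{m,j}=\frac{m}{\gcd(m,j)},$$ with $\mu$ the Möbius function, $\varphi$ Euler's totient function, and $\gcd(m,0)=m$. *)

theory Defs
  imports
    Complex_Main
    "HOL-Number_Theory.Totient"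
    "HOL-Computational_Algebra.Squarefree"
    "Graph_Theory.Graph_Theory"
begin

definition proper_divisors :: "nat \<Rightarrow> nat set" where
  "proper_divisors n = {d. d dvd n \<and> 1 \<le> d \<and> d < n}"

definition proper_divisors_avoiding :: "nat \<Rightarrow> nat \<Rightarrow> nat set" where
  "proper_divisors_avoiding n q = {d \<in> proper_divisors n. \<not> q dvd d}"

(* The subtraction is done in int because subtraction on nat truncates.  The arc
   relation is symmetric, and it is irreflexive whenever n is not in D. *)
definition ICG :: "nat \<Rightarrow> nat set \<Rightarrow> nat pair_pre_digraph" where
  "ICG n D = \<lparr> pverts = {0..<n},
     parcs = {(a, b). a < n \<and> b < n \<and> nat (gcd (int a - int b) (int n)) \<in> D} \<rparr>"

(* The constant "connected" of Complex_Main is topological connectedness; the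
   graph-theoretic one needs its qualified name. *)
definition ICG_connected :: "nat \<Rightarrow> nat set \<Rightarrow> bool" where
  "ICG_connected n D \<longleftrightarrow> Digraph_Component.connected (with_proj (ICG n D))"

definition moebius :: "nat \<Rightarrow> int" where
  "moebius m = (if squarefree m then (- 1) ^ card (prime_factors m) else 0)"

definition ramanujan_c :: "nat \<Rightarrow> nat \<Rightarrow> real" where
  "ramanujan_c j m =
     (let t = m div gcd m j
      in real_of_int (moebius t) * (real (totient m) / real (totient t)))"

definition ICG_eigenvalue :: "nat \<Rightarrow> nat set \<Rightarrow> nat \<Rightarrow> real" where
  "ICG_eigenvalue n D j = (\<Sum>d\<in>D. ramanujan_c j (n div d))"

end

theory Submission
  imports Defs
begin

text \<open>
  Let \<open>p\<close> be the least prime divisor of \<open>n\<close>, and write \<open>c j m\<close> for the Ramanujan sum. An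
  eigenvalue is a sum of terms \<open>c j m\<close> over a set of codivisors \<open>m = n / d\<close>, so for fixed \<open>j\<close> it
  is smallest when \<open>D\<close> selects exactly the negative terms. If \<open>n\<close> does not divide \<open>j\<close>, then the
  terms for all \<open>m dvd n\<close> cancel (lemma \<open>sum_ramanujan_c_divisors\<close>), hence the negative ones add
  up to \<open>- B / 2\<close>, where \<open>B\<close> is the sum of the absolute values. As a function of \<open>n\<close>, \<open>B\<close> is
  multiplicative over coprime factors, and its value at a prime power \<open>q ^ e\<close> is \<open>q ^ e\<close> if
  \<open>q ^ e dvd j\<close>, and \<open>2 * q ^ v\<close> if \<open>v < e\<close> is the exponent of \<open>q\<close> in \<open>j\<close>. A prime \<open>q\<close> of the
  second kind therefore brings \<open>B / n\<close> down by a factor of at least \<open>q / 2\<close>.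

  This makes \<open>B / 2\<close> equal to \<open>n / p\<close> when \<open>j\<close> is a multiple of \<open>n div p\<close> but not of \<open>n\<close>. For
  every other \<open>j\<close> that \<open>n\<close> does not divide, \<open>B / 2\<close> stays below \<open>n / p\<close> by at least \<open>\<delta>\<close>, where
  \<open>\<delta> = p - 1\<close> if \<open>p\<^sup>2 dvd n\<close> and \<open>\<delta> = 1\<close> otherwise (lemma \<open>half_sum_abs_ramanujan_c_le\<close>), and
  the bound \<open>- n / p + \<delta>\<close> holds for all \<open>D\<close>.

  If \<open>n dvd j\<close>, then all terms are totients and the eigenvalue is nonnegative. It remains to
  treat multiples \<open>j\<close> of \<open>n div p\<close> that are not multiples of \<open>n\<close>. For these, \<open>c j m\<close> is
  \<open>totient m\<close> if \<open>m dvd n div p\<close> and \<open>- totient m / (p - 1)\<close> if not. No term vanishes, so the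
  divisors \<open>d\<close> with negative terms, which are those not divisible by \<open>p\<close>, form the only set with
  the eigenvalue \<open>- n / p\<close>. Any other \<open>D\<close> adds a positive term or omits a negative one, and
  thereby gains at least the smallest \<open>\<bar>c j m\<bar>\<close> with \<open>m \<noteq> 1\<close>, the term for \<open>m = 1\<close> being out of
  reach as \<open>d < n\<close>. That minimum is \<open>\<delta>\<close>, attained at \<open>m = p\<close>: this term is \<open>p - 1\<close>, hence to be
  added, if \<open>p\<^sup>2 dvd n\<close>, and it is \<open>- 1\<close>, hence to be removed, otherwise. So the exchange of
  \<open>d = n div p\<close> gives both the bound (lemma \<open>ICG_eigenvalue_ge_of_cofactor_dvd\<close>) and the two
  families of equality cases. For \<open>n = 6\<close> the other \<open>j\<close> reach the bound as well, since there
  \<open>n / p - \<delta> = 2\<close> is also the value of \<open>B / 2\<close> at \<open>j = 1, 2, 4, 5\<close>.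
\<close>

section \<open>Ramanujan sums\<close>

lemma moebius_mult_coprime:
  assumes "coprime a b"
  shows "moebius (a * b) = moebius a * moebius b"
proof (cases "squarefree a \<and> squarefree b")
  case True
  then have "a \<noteq> 0" "b \<noteq> 0" by (metis not_squarefree_0)+
  moreover have "prime_factors a \<inter> prime_factors b = {}"
    using assms by (meson coprime_common_divisor disjoint_iff in_prime_factors_imp_dvd
        in_prime_factors_imp_prime not_prime_unit)
  ultimately have "card (prime_factors (a * b)) = card (prime_factors a) + card (prime_factors b)"
    by (simp add: prime_factors_product card_Un_disjoint)
  with True assms show ?thesis
    by (simp add: moebius_def squarefree_mult_coprime power_add)
next
  case False
  then have "\<not> squarefree (a * b)" by (meson squarefree_multD)
  with False show ?thesis by (auto simp: moebius_def)
qed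

lemma abs_moebius_le_1: "\<bar>moebius m\<bar> \<le> 1"
  by (simp add: moebius_def power_abs)

lemma moebius_prime: "prime q \<Longrightarrow> moebius q = - 1"
  by (simp add: moebius_def squarefree_prime prime_factorization_prime)

lemma gcd_mult_coprime_nat:
  fixes a b j :: nat
  assumes "coprime a b"
  shows "gcd (a * b) j = gcd a j * gcd b j"
proof (rule dvd_antisym)
  obtain x y where "gcd (a * b) j = x * y" "x dvd a" "y dvd b"
    using division_decomp[of "gcd (a * b) j" a b] by auto
  moreover from this have "x dvd j" "y dvd j"
    by (metis dvd_mult_left dvd_mult_right gcd_dvd2)+
  ultimately show "gcd (a * b) j dvd gcd a j * gcd b j"
    by (auto intro: mult_dvd_mono)
next
  have "coprime (gcd a j) (gcd b j)"
    using assms by (meson coprime_divisors gcd_dvd1)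
  then show "gcd a j * gcd b j dvd gcd (a * b) j"
    by (auto intro: divides_mult mult_dvd_mono)
qed

lemma ramanujan_c_mult_coprime:
  assumes "coprime a b" "a > 0" "b > 0"
  shows "ramanujan_c j (a * b) = ramanujan_c j a * ramanujan_c j b"
proof -
  define s t where "s = a div gcd a j" and "t = b div gcd b j"
  have "gcd (a * b) j = gcd a j * gcd b j"
    using assms(1) by (rule gcd_mult_coprime_nat)
  then have "a * b div gcd (a * b) j = s * t"
    by (simp add: s_def t_def div_mult_div_if_dvd)
  moreover have "s dvd a"
    unfolding s_def by (metis dvd_div_mult_self dvd_triv_left gcd_dvd1)
  moreover have "t dvd b"
    unfolding t_def by (metis dvd_div_mult_self dvd_triv_left gcd_dvd1)
  moreover from calculation(2,3) have "coprime s t"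
    using assms(1) by (meson coprime_divisors)
  ultimately show ?thesis
    using assms(1)
    by (simp add: ramanujan_c_def Let_def moebius_mult_coprime totient_mult_coprime
        flip: s_def t_def)
qed

lemma abs_ramanujan_c_le: "\<bar>ramanujan_c j m\<bar> \<le> totient m"
proof -
  define t where "t = m div gcd m j"
  have "real (totient m) / real (totient t) \<le> totient m"
    by (cases "totient t = 0") (auto simp: divide_le_eq mult_le_cancel_left1 Suc_le_eq)
  moreover have "\<bar>real_of_int (moebius t)\<bar> \<le> 1"
    using abs_moebius_le_1[of t] by linarith
  ultimately show ?thesis
    unfolding ramanujan_c_def Let_def t_def[symmetric] abs_mult
    using mult_mono[of "\<bar>real_of_int (moebius t)\<bar>" 1 "\<bar>real (totient m) / real (totient t)\<bar>" "totient m"]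
    by simp
qed

lemma ramanujan_c_dvd:
  assumes "m dvd j" "m > 0"
  shows "ramanujan_c j m = totient m"
  using assms by (simp add: ramanujan_c_def moebius_def gcd_nat.absorb1)

lemma ramanujan_c_prime_quotient:
  assumes "prime q" "m div gcd m j = q"
  shows "ramanujan_c j m = - (real (totient m) / (real q - 1))"
  using assms prime_gt_1_nat[of q]
  by (simp add: ramanujan_c_def moebius_prime totient_prime of_nat_diff)

section \<open>Sums over divisors\<close>

text \<open>The divisors of \<open>a * b\<close> are the products of a divisor of \<open>a\<close> and a divisor of \<open>b\<close>, uniquely so
  because \<open>d = gcd d a * gcd d b\<close>.\<close>

lemma sum_divisors_mult_coprime:
  fixes f :: "nat \<Rightarrow> real"
  assumes ab: "coprime a b" "a > 0" "b > 0"
    and f: "\<And>x y. coprime x y \<Longrightarrow> x > 0 \<Longrightarrow> y > 0 \<Longrightarrow> f (x * y) = f x * f y"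
  shows "(\<Sum>d | d dvd a * b. f d) = (\<Sum>d | d dvd a. f d) * (\<Sum>d | d dvd b. f d)"
proof -
  have "bij_betw (\<lambda>(x, y). x * y) ({d. d dvd a} \<times> {d. d dvd b}) {d. d dvd a * b}"
  proof (rule bij_betwI[where g = "\<lambda>d. (gcd d a, gcd d b)"])
    show "(\<lambda>(x, y). x * y) \<in> {d. d dvd a} \<times> {d. d dvd b} \<rightarrow> {d. d dvd a * b}"
      by (auto intro: mult_dvd_mono)
    show "(\<lambda>d. (gcd d a, gcd d b)) \<in> {d. d dvd a * b} \<rightarrow> {d. d dvd a} \<times> {d. d dvd b}"
      by auto
    have *: "gcd (x * y) a = x" if "x dvd a" "coprime y a" for x y a :: nat
      using that by (simp add: gcd_mult_left_right_cancel coprime_commute gcd_nat.absorb1)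
    show "(\<lambda>d. (gcd d a, gcd d b)) ((\<lambda>(x, y). x * y) z) = z"
      if "z \<in> {d. d dvd a} \<times> {d. d dvd b}" for z
    proof -
      obtain x y where z: "z = (x, y)" "x dvd a" "y dvd b" using \<open>z \<in> _\<close> by blast
      have "coprime y a" "coprime x b"
        using ab(1) z by (meson coprime_divisors coprime_commute dvd_refl)+
      then show ?thesis
        using z *[of x a y] *[of y b x] by (simp add: mult.commute)
    qed
    show "(\<lambda>(x, y). x * y) (gcd d a, gcd d b) = d" if "d \<in> {d. d dvd a * b}" for d
      using that ab(1) gcd_mult_coprime_nat[of a b d] by (simp add: gcd.commute gcd_nat.absorb1)
  qed
  then have "(\<Sum>d | d dvd a * b. f d) = (\<Sum>(x, y)\<in>{d. d dvd a} \<times> {d. d dvd b}. f (x * y))"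
    by (subst sum.reindex_bij_betw[symmetric]) (auto simp: case_prod_unfold)
  also have "\<dots> = (\<Sum>(x, y)\<in>{d. d dvd a} \<times> {d. d dvd b}. f x * f y)"
    using ab by (intro sum.cong) (auto intro!: f intro: coprime_divisors dvd_pos_nat)
  also have "\<dots> = (\<Sum>d | d dvd a. f d) * (\<Sum>d | d dvd b. f d)"
    by (simp add: sum_product sum.cartesian_product)
  finally show ?thesis .
qed

text \<open>From the exponent \<open>Suc v\<close> on, the quotient of \<open>q ^ i\<close> by its greatest common divisor with \<open>j\<close> is
  \<open>q ^ (i - v)\<close>; the Moebius function leaves only the first of these powers.\<close>

lemma ramanujan_c_prime_power:
  assumes q: "prime q" and v: "q ^ v dvd j" "\<not> q ^ Suc v dvd j"
  shows "ramanujan_c j (q ^ i) =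
    (if i \<le> v then real (totient (q ^ i)) else if i = Suc v then - (real q ^ v) else 0)"
proof -
  have q1: "q > 1" using q prime_gt_1_nat by blast
  consider "i \<le> v" | w where "i = v + Suc w"
    by (metis add_Suc_right less_iff_Suc_add not_le)
  then show ?thesis
  proof cases
    case 1
    then have "q ^ i dvd j" using v(1) by (meson dvd_trans le_imp_power_dvd)
    with 1 q1 show ?thesis by (simp add: ramanujan_c_dvd)
  next
    case 2
    have "gcd (q ^ i) j = q ^ v"
    proof -
      obtain u where u: "u \<le> i" "gcd (q ^ i) j = q ^ u"
        using divides_primepow_nat[OF q, of "gcd (q ^ i) j" i] by auto
      have "q ^ v dvd q ^ u" unfolding u(2)[symmetric]
        using v(1) 2 by (simp add: le_imp_power_dvd)
      then have "v \<le> u" using q1 by (rule power_dvd_imp_le)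
      moreover have "\<not> Suc v \<le> u"
        using v(2) u(2) by (metis dvd_trans gcd_dvd2 le_imp_power_dvd)
      ultimately have "u = v" by simp
      with u show ?thesis by simp
    qed
    then have t: "q ^ i div gcd (q ^ i) j = q ^ Suc w"
      using 2 q1 by (simp add: power_add)
    show ?thesis
    proof (cases w)
      case 0
      have "totient (q ^ i) = q ^ v * (q - 1)"
        using 0 2 q by (simp add: totient_prime_power_Suc del: power_Suc)
      then have "ramanujan_c j (q ^ i) = - (real (q ^ v * (q - 1)) / (real q - 1))"
        using ramanujan_c_prime_quotient[OF q, of "q ^ i" j] t 0 by simp
      with q1 0 2 show ?thesis by (simp add: of_nat_diff)
    next
      case (Suc w')
      have "\<not> squarefree (q ^ Suc w)"
        using q1 Suc by (simp add: squarefree_power_iff del: power_Suc)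
      with t 2 Suc show ?thesis by (simp add: ramanujan_c_def moebius_def Let_def)
    qed
  qed
qed

text \<open>If \<open>v < e\<close> is the exponent of \<open>q\<close> in \<open>j\<close>, the positive terms are the totients of the divisors of
  \<open>q ^ v\<close>, with sum \<open>q ^ v\<close>, and the only other nonzero term is \<open>- (q ^ v)\<close>.\<close>

lemma sum_ramanujan_c_prime_power:
  assumes q: "prime q" and e: "\<not> q ^ e dvd j"
  shows "(\<Sum>d | d dvd q ^ e. ramanujan_c j d) = 0"
    and "\<not> q ^ Suc i dvd j \<Longrightarrow> (\<Sum>d | d dvd q ^ e. \<bar>ramanujan_c j d\<bar>) \<le> 2 * real q ^ i"
proof -
  have q1: "q > 1" using q prime_gt_1_nat by blast
  have j: "j > 0" using e by (auto intro: gr0I)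
  define v where "v = multiplicity q j"
  have v: "q ^ v dvd j" "\<not> q ^ Suc v dvd j"
    using j q1 by (auto simp: v_def multiplicity_dvd power_dvd_iff_le_multiplicity
        simp del: power_Suc)
  have ve: "v < e" using e v(1) by (meson dvd_trans le_imp_power_dvd not_le)
  \<comment> \<open>Both claims are instances: the identity for \<open>g\<close> in the first, the absolute value in the second.\<close>
  have main: "(\<Sum>d | d dvd q ^ e. g (ramanujan_c j d)) = real q ^ v + g (- (real q ^ v))"
    if g: "g 0 = 0" "\<And>x. x \<ge> 0 \<Longrightarrow> g x = x" for g :: "real \<Rightarrow> real"
  proof -
    have "{d. d dvd q ^ e} = (\<lambda>i. q ^ i) ` {..e}"
      using divides_primepow_nat[OF q] by auto
    then have "(\<Sum>d | d dvd q ^ e. g (ramanujan_c j d)) = (\<Sum>i\<le>e. g (ramanujan_c j (q ^ i)))"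
      using q1 by (simp add: sum.reindex inj_on_def)
    also have "\<dots> = (\<Sum>i\<le>Suc v. g (ramanujan_c j (q ^ i)))"
      using ve ramanujan_c_prime_power[OF q v] g by (intro sum.mono_neutral_right) auto
    also have "\<dots> = (\<Sum>i\<le>v. real (totient (q ^ i))) + g (- (real q ^ v))"
      using ramanujan_c_prime_power[OF q v] g by simp
    also have "(\<Sum>i\<le>v. real (totient (q ^ i))) = real q ^ v"
    proof -
      have "{d. d dvd q ^ v} = (\<lambda>i. q ^ i) ` {..v}"
        using divides_primepow_nat[OF q] by auto
      then have "(\<Sum>i\<le>v. totient (q ^ i)) = (\<Sum>d | d dvd q ^ v. totient d)"
        using q1 by (simp add: sum.reindex inj_on_def)
      also have "\<dots> = q ^ v" by (rule totient_divisor_sum)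
      finally show ?thesis by (metis of_nat_sum of_nat_power)
    qed
    finally show ?thesis .
  qed
  show "(\<Sum>d | d dvd q ^ e. ramanujan_c j d) = 0"
    using main[of "\<lambda>x. x"] by simp
  assume "\<not> q ^ Suc i dvd j"
  then have "v \<le> i"
    using v(1) by (meson dvd_trans le_imp_power_dvd not_less_eq_eq)
  then have "real q ^ v \<le> real q ^ i"
    using q1 by (simp add: power_increasing)
  with main[of abs] show "(\<Sum>d | d dvd q ^ e. \<bar>ramanujan_c j d\<bar>) \<le> 2 * real q ^ i"
    by simp
qed

text \<open>The full power of \<open>q\<close> in \<open>n\<close> is split off; its exponent is written as a successor because the
  estimates below involve the exponent that is smaller by one.\<close>

lemma prime_part_not_dvd:
  fixes n j q :: nat
  assumes "n > 0" "j > 0" "prime q" "multiplicity q j < multiplicity q n"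
  obtains e m where "n = q ^ Suc e * m" "\<not> q dvd m" "m > 0" "\<not> q ^ Suc e dvd j"
proof -
  obtain e where e: "multiplicity q n = Suc e"
    using assms(4) by (cases "multiplicity q n") auto
  obtain m where m: "n = q ^ Suc e * m" "\<not> q dvd m"
    using multiplicity_decompose'[of n q] assms(1,3) e by (metis not_prime_unit gr_implies_not0)
  have "\<not> q ^ Suc e dvd j"
    using assms e by (metis power_dvd_iff_le_multiplicity gr_implies_not0 not_le not_prime_unit)
  moreover have "m > 0" using m(2) by (auto intro: gr0I)
  ultimately show thesis using that m by blast
qed

text \<open>One prime power of \<open>n\<close> that fails to divide \<open>j\<close> contributes the factor zero.\<close>

lemma sum_ramanujan_c_divisors:
  assumes "n > 0" "\<not> n dvd j"
  shows "(\<Sum>m | m dvd n. ramanujan_c j m) = 0"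
proof -
  have "j > 0" using assms(2) by (auto intro: gr0I)
  obtain q where "prime q" "multiplicity q j < multiplicity q n"
    using assms by (metis gr_implies_not0 multiplicity_le_imp_dvd not_le)
  then obtain e m where m: "prime q" "n = q ^ Suc e * m" "\<not> q dvd m" "m > 0" "\<not> q ^ Suc e dvd j"
    using prime_part_not_dvd assms(1) \<open>j > 0\<close> by metis
  have "coprime (q ^ Suc e) m"
    using m(1,3) by (simp add: prime_imp_coprime del: power_Suc)
  then show ?thesis
    unfolding m(2)
    using sum_divisors_mult_coprime[of "q ^ Suc e" m "ramanujan_c j"] m ramanujan_c_mult_coprime
      sum_ramanujan_c_prime_power(1)[OF m(1,5)] prime_gt_0_nat by simp
qed

lemma sum_abs_ramanujan_c_le: "(\<Sum>m | m dvd n. \<bar>ramanujan_c j m\<bar>) \<le> n"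
proof -
  have "(\<Sum>m | m dvd n. \<bar>ramanujan_c j m\<bar>) \<le> (\<Sum>m | m dvd n. real (totient m))"
    by (intro sum_mono abs_ramanujan_c_le)
  also have "\<dots> = n" by (metis of_nat_sum totient_divisor_sum)
  finally show ?thesis .
qed

text \<open>This splits off a prime \<open>q\<close> whose exponent in \<open>j\<close> is at most \<open>i\<close>: compared with the trivial bound of
  \<open>sum_abs_ramanujan_c_le\<close>, the factor \<open>q ^ e\<close> is replaced by \<open>2 * q ^ i\<close>.\<close>

lemma sum_abs_ramanujan_c_mult_le:
  assumes q: "prime q" and m: "\<not> q dvd m" "m > 0" and "\<not> q ^ Suc i dvd j" "i < e"
  shows "(\<Sum>d | d dvd q ^ e * m. \<bar>ramanujan_c j d\<bar>)
    \<le> 2 * real q ^ i * (\<Sum>d | d dvd m. \<bar>ramanujan_c j d\<bar>)"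
proof -
  have "coprime (q ^ e) m"
    using m(1) q by (simp add: prime_imp_coprime)
  then have "(\<Sum>d | d dvd q ^ e * m. \<bar>ramanujan_c j d\<bar>)
    = (\<Sum>d | d dvd q ^ e. \<bar>ramanujan_c j d\<bar>) * (\<Sum>d | d dvd m. \<bar>ramanujan_c j d\<bar>)"
    using m(2) q by (intro sum_divisors_mult_coprime)
      (auto simp: ramanujan_c_mult_coprime abs_mult prime_gt_0_nat)
  moreover have "\<not> q ^ e dvd j"
    using assms(4,5) by (meson Suc_leI dvd_trans le_imp_power_dvd)
  then have "(\<Sum>d | d dvd q ^ e. \<bar>ramanujan_c j d\<bar>) \<le> 2 * real q ^ i"
    using sum_ramanujan_c_prime_power(2)[OF q] assms(4) by blast
  ultimately show ?thesis
    by (simp add: mult_right_mono sum_nonneg)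
qed

lemma sum_codivisors:
  fixes f :: "nat \<Rightarrow> real"
  assumes "n > 0"
  shows "(\<Sum>d | d dvd n \<and> P (n div d). f (n div d)) = (\<Sum>m | m dvd n \<and> P m. f m)"
  using assms
  by (intro sum.reindex_bij_witness[of _ "\<lambda>m. n div m" "\<lambda>d. n div d"]) (auto elim!: dvdE)

text \<open>No choice of \<open>D\<close> does better than to select all negative terms, and these make up half of the
  absolute sum because all terms together cancel.\<close>

lemma ICG_eigenvalue_ge_sum_abs:
  assumes "n > 0" "\<not> n dvd j" "D \<subseteq> proper_divisors n"
  shows "ICG_eigenvalue n D j \<ge> - (\<Sum>m | m dvd n. \<bar>ramanujan_c j m\<bar>) / 2"
proof -
  let ?h = "\<lambda>m. max 0 (- ramanujan_c j m)"
  have "- ICG_eigenvalue n D j \<le> (\<Sum>d\<in>D. ?h (n div d))"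
    unfolding ICG_eigenvalue_def sum_negf[symmetric] by (intro sum_mono) simp
  also have "\<dots> \<le> (\<Sum>d | d dvd n. ?h (n div d))"
    using assms(1,3) by (intro sum_mono2) (auto simp: proper_divisors_def)
  also have "\<dots> = (\<Sum>m | m dvd n. ?h m)"
    using sum_codivisors[OF assms(1), of ?h "\<lambda>_. True"] by simp
  also have "\<dots> = (\<Sum>m | m dvd n. (\<bar>ramanujan_c j m\<bar> - ramanujan_c j m) / 2)"
    by (intro sum.cong) auto
  also have "\<dots> = (\<Sum>m | m dvd n. \<bar>ramanujan_c j m\<bar>) / 2"
    using sum_ramanujan_c_divisors[OF assms(1,2)]
    by (simp add: sum_subtractf flip: sum_divide_distrib)
  finally show ?thesis by simp
qed

section \<open>Indices that are not multiples of the largest cofactor\<close>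

text \<open>
  Let \<open>B\<close> be the sum of the absolute values, and call a prime deficient if its exponent in \<open>j\<close> is
  below its exponent in \<open>n\<close>.  Two deficient primes
  \<open>q < r\<close> give \<open>B / 2 \<le> 2 * n / (q * r) \<le> 2 * n / (p * r)\<close>, where \<open>r \<ge> 3\<close>.  A single deficient
  prime \<open>q \<noteq> p\<close> gives \<open>B / 2 \<le> n / q\<close>, where \<open>q \<ge> p + 1\<close>.  In both situations \<open>B / 2\<close> is smaller
  than \<open>n / p\<close> by at least \<open>n / (p * r)\<close> or \<open>n / (p * q)\<close>.  This is at least the required gap, because it
  is a positive integer, and a multiple of \<open>p\<close> if \<open>p\<^sup>2 dvd n\<close>.  If
  \<open>p\<close> is the only deficient prime, then its exponent in \<open>j\<close> is short by two or more, as \<open>n div p\<close> does not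
  divide \<open>j\<close>, and \<open>B / 2 \<le> n / p\<^sup>2\<close>, which is smaller than \<open>n / p\<close> by \<open>(p - 1) * n / p\<^sup>2 \<ge> p - 1\<close>.
\<close>

lemma half_sum_abs_ramanujan_c_le:
  fixes n p j :: nat
  assumes p: "prime p" "p dvd n" "\<And>q. prime q \<Longrightarrow> q dvd n \<Longrightarrow> p \<le> q"
    and n: "n > 0"
    and j: "\<not> n dvd j" "\<not> n div p dvd j"
  shows "(\<Sum>d | d dvd n. \<bar>ramanujan_c j d\<bar>) / 2 + (if p\<^sup>2 dvd n then real p - 1 else 1)
    \<le> real n / real p"
proof -
  let ?B = "\<lambda>n. \<Sum>d | d dvd n. \<bar>ramanujan_c j d\<bar>"
  let ?\<delta> = "if p\<^sup>2 dvd n then real p - 1 else 1"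
  have p1: "p > 1" using p(1) by (rule prime_gt_1_nat)
  have \<delta>: "?\<delta> \<le> real n / (real p * real q)" if q: "prime q" "q \<noteq> p" "q dvd n" for q
  proof -
    have "coprime p q" using p(1) q by (simp add: primes_coprime)
    have q0: "q > 0" using q(1) by (rule prime_gt_0_nat)
    show ?thesis
    proof (cases "p\<^sup>2 dvd n")
      case True
      then have "p\<^sup>2 * q dvd n" using q(3) \<open>coprime p q\<close> by (simp add: divides_mult)
      then have "real (p\<^sup>2 * q) \<le> real n" using n by (simp only: of_nat_le_iff dvd_imp_le)
      then have "real p \<le> real n / (real p * real q)"
        using p1 q0 by (simp add: field_simps power2_eq_square)
      with True show ?thesis by simp
    next
      case False
      have "p * q dvd n" using p(2) q(3) \<open>coprime p q\<close> by (simp add: divides_mult)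
      then have "real (p * q) \<le> real n" using n by (simp only: of_nat_le_iff dvd_imp_le)
      with False show ?thesis using p1 q0 by (simp add: field_simps)
    qed
  qed
  have "j > 0" using j(1) by (auto intro: gr0I)
  define Q where "Q = {q. prime q \<and> multiplicity q j < multiplicity q n}"
  have Q_decomp: "\<exists>e k. n = q ^ Suc e * k \<and> \<not> q dvd k \<and> k > 0 \<and> \<not> q ^ Suc e dvd j"
    if "q \<in> Q" for q
    using prime_part_not_dvd[OF n \<open>j > 0\<close>] that unfolding Q_def by blast
  have Q_le: "?B (q ^ Suc e * k) \<le> 2 * real q ^ e * ?B k"
    if "prime q" "\<not> q dvd k" "k > 0" "\<not> q ^ Suc e dvd j" for q e k
    using sum_abs_ramanujan_c_mult_le[OF that] by blast
  have Q_dvd: "prime q" "q dvd n" "p \<le> q" if "q \<in> Q" for q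
  proof -
    show "prime q" using that by (simp add: Q_def)
    show "q dvd n" using Q_decomp[OF that] by (auto intro: dvd_mult2)
    then show "p \<le> q" using p(3) \<open>prime q\<close> by blast
  qed
  have "Q \<noteq> {}"
  proof -
    have "\<exists>q. prime q \<and> multiplicity q j < multiplicity q n"
      using n j(1) by (metis gr_implies_not0 multiplicity_le_imp_dvd not_le)
    then show ?thesis by (simp add: Q_def)
  qed
  show ?thesis
  proof (cases "\<exists>q r. q \<in> Q \<and> r \<in> Q \<and> q < r")
    case True
    then obtain q r where qr: "q \<in> Q" "r \<in> Q" "q < r" by blast
    obtain e k where k: "n = q ^ Suc e * k" "\<not> q dvd k" "k > 0" "\<not> q ^ Suc e dvd j"
      using Q_decomp[OF qr(1)] by blast
    obtain f l where l: "n = r ^ Suc f * l" "\<not> r dvd l" "l > 0" "\<not> r ^ Suc f dvd j"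
      using Q_decomp[OF qr(2)] by blast
    \<comment> \<open>The factor split off for \<open>r\<close> is also the full power of \<open>r\<close> in \<open>k\<close>, so \<open>q\<close> and \<open>r\<close> can be
      split off one after the other.\<close>
    have "coprime (r ^ Suc f) (q ^ Suc e)"
      using primes_coprime[of r q] Q_dvd(1) qr by (simp del: power_Suc)
    moreover have "r ^ Suc f dvd q ^ Suc e * k" using l(1) k(1) by (metis dvd_triv_left)
    ultimately have "r ^ Suc f dvd k" by (metis coprime_dvd_mult_right_iff)
    then obtain k' where k': "k = r ^ Suc f * k'" by blast
    have k'0: "k' > 0" using k(3) k' by (auto intro: gr0I)
    have nr: "\<not> r dvd k'"
    proof
      assume "r dvd k'"
      then have "r ^ Suc f * r dvd r ^ Suc f * l"
        unfolding l(1)[symmetric] k(1) k' by (intro dvd_mult mult_dvd_mono) auto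
      then show False using l(2) Q_dvd(1)[OF qr(2)] by auto
    qed
    have "?B n \<le> 2 * real q ^ e * ?B k"
      unfolding k(1) using Q_dvd(1) qr k by (intro Q_le) auto
    also have "?B k \<le> 2 * real r ^ f * ?B k'"
      unfolding k' using Q_dvd(1) qr k'0 nr l by (intro Q_le) auto
    also have "?B k' \<le> k'" by (rule sum_abs_ramanujan_c_le)
    finally have "?B n \<le> 2 * real q ^ e * (2 * real r ^ f * k')"
      by (simp add: mult_left_mono)
    also have "\<dots> = 4 * (real n / (real q * real r))"
      using Q_dvd(1)[OF qr(1)] Q_dvd(1)[OF qr(2)] prime_gt_0_nat
      by (simp add: k(1) k')
    also have "\<dots> \<le> 4 * (real n / (real p * real r))"
      using Q_dvd(3)[OF qr(1)] p1 Q_dvd(1)[OF qr(2)] prime_gt_0_nat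
      by (intro mult_left_mono divide_left_mono mult_right_mono) auto
    finally have "?B n / 2 \<le> 2 * (real n / (real p * real r))" by simp
    moreover have "?\<delta> \<le> real n / (real p * real r)"
      using \<delta>[OF Q_dvd(1)[OF qr(2)] _ Q_dvd(2)[OF qr(2)]] Q_dvd(3)[OF qr(1)] qr(3) by simp
    moreover have "3 * (real n / (real p * real r)) \<le> real n / real p"
    proof -
      have "r \<ge> 3" using qr Q_dvd(3)[OF qr(1)] p1 by simp
      then have "3 * real n \<le> real r * real n" by (intro mult_right_mono) auto
      then show ?thesis using p1 \<open>r \<ge> 3\<close> by (simp add: field_simps)
    qed
    ultimately show ?thesis by linarith
  next
    case False
    with \<open>Q \<noteq> {}\<close> obtain q where q: "Q = {q}"
      by (metis is_singletonI' is_singleton_def linorder_neqE_nat)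
    obtain e k where k: "n = q ^ Suc e * k" "\<not> q dvd k" "k > 0" "\<not> q ^ Suc e dvd j"
      using Q_decomp[of q] q by blast
    note qd = Q_dvd[of q, unfolded q, simplified]
    show ?thesis
    proof (cases "q = p")
      case True
      have n': "n div p = p ^ e * k" using k(1) True p1 by simp
      \<comment> \<open>No prime of \<open>k\<close> is deficient, so it is the power of \<open>p\<close> that keeps \<open>n div p\<close> from dividing \<open>j\<close>.\<close>
      have kj: "k dvd j"
      proof (rule multiplicity_le_imp_dvd)
        show "k \<noteq> 0" using k by simp
        fix r :: nat assume r: "prime r"
        show "multiplicity r k \<le> multiplicity r j"
        proof (cases "r = q")
          case True then show ?thesis using k(2) by (simp add: not_dvd_imp_multiplicity_0)
        next
          case False
          then have "\<not> multiplicity r j < multiplicity r n" using q r by (auto simp: Q_def)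
          moreover have "multiplicity r k \<le> multiplicity r n"
            using k(1) n by (intro dvd_imp_multiplicity_le) auto
          ultimately show ?thesis by simp
        qed
      qed
      have "\<not> p ^ e dvd j"
        using j(2) n' kj k(2) True p(1) by (metis divides_mult prime_imp_coprime coprime_power_left_iff)
      then obtain e' where e': "e = Suc e'" by (cases e) auto
      have "p\<^sup>2 dvd n" using k(1) True e' by (simp add: power2_eq_square)
      have "?B n \<le> 2 * real p ^ e' * ?B k"
        unfolding k(1) True using True k p(1) \<open>\<not> p ^ e dvd j\<close> e'
        by (intro sum_abs_ramanujan_c_mult_le) auto
      also have "\<dots> \<le> 2 * real p ^ e' * k"
        by (intro mult_left_mono sum_abs_ramanujan_c_le) auto
      finally have "?B n / 2 \<le> real p ^ e' * real k" by simp
      moreover have "real n / real p = real p * (real p ^ e' * real k)"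
        using p1 by (simp add: k(1) True e')
      moreover have "(real p - 1) * 1 \<le> (real p - 1) * (real p ^ e' * real k)"
      proof (intro mult_left_mono)
        have "1 \<le> p ^ e' * k" using p1 k(3) by simp
        then show "1 \<le> real p ^ e' * real k" by (metis of_nat_1 of_nat_le_iff of_nat_mult of_nat_power)
      qed (use p1 in simp)
      ultimately show ?thesis using \<open>p\<^sup>2 dvd n\<close> by (simp add: algebra_simps)
    next
      case False
      have "?B n \<le> 2 * real q ^ e * ?B k"
        unfolding k(1) using qd k by (intro Q_le) auto
      also have "\<dots> \<le> 2 * real q ^ e * k"
        by (intro mult_left_mono sum_abs_ramanujan_c_le) auto
      finally have "?B n / 2 \<le> real n / real q"
        using qd(1) prime_gt_0_nat[of q] by (simp add: k(1))
      moreover have "?\<delta> \<le> real n / (real p * real q)"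
        using \<delta> qd False by blast
      moreover have "real n / real q + real n / (real p * real q) \<le> real n / real p"
      proof -
        have "p + 1 \<le> q" using qd(3) False by simp
        then have "(real p + 1) * real n \<le> real q * real n"
          by (intro mult_right_mono) auto
        then have "(real p + 1) * real n / (real p * real q) \<le> real q * real n / (real p * real q)"
          by (rule divide_right_mono) simp
        then show ?thesis using p1 \<open>p + 1 \<le> q\<close> by (simp add: field_simps)
      qed
      ultimately show ?thesis by linarith
    qed
  qed
qed

section \<open>Indices that are multiples of the largest cofactor\<close>

text \<open>Here \<open>gcd n j = n div p\<close>, so \<open>gcd m j = gcd m (n div p)\<close>, and the quotient of \<open>m\<close> by it is a
  divisor of \<open>p\<close> different from \<open>1\<close>.\<close>

lemma div_gcd_eq_of_cofactor_dvd:
  fixes n p j :: nat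
  assumes "prime p" "p dvd n" "n > 0" "n div p dvd j" "\<not> n dvd j" "m dvd n"
    and m: "\<not> m dvd n div p"
  shows "m div gcd m j = p"
proof -
  obtain r where r: "n = p * r" using assms(2) by blast
  have p0: "p > 0" using assms(1) by (rule prime_gt_0_nat)
  have r': "n div p = r" using r p0 by simp
  define g where "g = gcd m r"
  have "m dvd p * g"
    using assms(6) r by (simp add: g_def gcd_mult_distrib_nat)
  moreover obtain u where u: "m = g * u" unfolding g_def by (meson dvdE gcd_dvd1)
  moreover have "m > 0" using assms(3,6) by (rule dvd_pos_nat)
  ultimately have "u dvd p" by (auto simp: mult.commute)
  moreover have "u \<noteq> 1" using m u r' by (metis g_def gcd_dvd2 mult.right_neutral)
  ultimately have "u = p" using assms(1) by (metis prime_nat_iff)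
  have "gcd m j = g"
  proof -
    have "r dvd gcd n j" using assms(4) r r' by simp
    then obtain w where w: "gcd n j = r * w" by blast
    have "r * w dvd r * p" unfolding w[symmetric] using r by (simp add: mult.commute)
    then have "w dvd p" using r assms(3) by simp
    moreover have "w \<noteq> p" using w r assms(5) by (metis gcd_dvd2 mult.commute)
    ultimately have "w = 1" using assms(1) by (metis prime_nat_iff)
    then have "gcd n j = r" using w by simp
    moreover have "gcd m j = gcd m (gcd n j)"
      using assms(6) by (simp add: gcd_nat.absorb1 flip: gcd.assoc)
    ultimately show ?thesis by (simp add: g_def)
  qed
  then show ?thesis using u \<open>u = p\<close> \<open>m > 0\<close> by auto
qed

text \<open>In terms of the codivisor \<open>n div d\<close>, the set is described by the sign of the Ramanujan sum at a
  multiple of \<open>n div p\<close>.  The divisor \<open>d = n\<close> is excluded automatically because \<open>p dvd n\<close>.\<close>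

lemma proper_divisors_avoiding_eq:
  assumes "prime p" "p dvd n" "n > 0"
  shows "proper_divisors_avoiding n p = {d. d dvd n \<and> \<not> n div d dvd n div p}"
proof -
  have *: "n div d dvd n div p \<longleftrightarrow> p dvd d" if "d dvd n" for d
  proof -
    obtain e r where e: "n = d * e" "n = p * r" using \<open>d dvd n\<close> assms(2) unfolding dvd_def by blast
    then have "e > 0" "d > 0" "p > 0" using assms(3) by (auto intro: gr0I)
    then have "n div d dvd n div p \<longleftrightarrow> p * e dvd p * r" using e by (metis dvd_times_left_cancel_iff
      nonzero_mult_div_cancel_left not_gr_zero)
    then show ?thesis using e \<open>e > 0\<close> by (metis dvd_times_right_cancel_iff not_gr_zero)
  qed
  show ?thesis
    using assms by (auto simp: proper_divisors_avoiding_def proper_divisors_def * dvd_pos_nat Suc_le_eq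
        intro!: le_neq_implies_less dvd_imp_le)
qed

text \<open>The totients of the divisors of \<open>n\<close> that do not divide \<open>n div p\<close> add up to
  \<open>n - n div p = (p - 1) * (n / p)\<close>, and every term is a totient divided by \<open>- (p - 1)\<close>.\<close>

lemma ICG_eigenvalue_avoiding:
  assumes "prime p" "p dvd n" "n > 0" "n div p dvd j" "\<not> n dvd j"
  shows "ICG_eigenvalue n (proper_divisors_avoiding n p) j = - (real n / real p)"
proof -
  have p1: "p > 1" using assms(1) by (rule prime_gt_1_nat)
  have "ICG_eigenvalue n (proper_divisors_avoiding n p) j
      = (\<Sum>d | d dvd n \<and> \<not> n div d dvd n div p. ramanujan_c j (n div d))"
    by (simp add: ICG_eigenvalue_def proper_divisors_avoiding_eq[OF assms(1-3)])
  also have "\<dots> = (\<Sum>m | m dvd n \<and> \<not> m dvd n div p. ramanujan_c j m)"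
    using assms(3) by (rule sum_codivisors)
  also have "\<dots> = (\<Sum>m | m dvd n \<and> \<not> m dvd n div p. - (real (totient m) / (real p - 1)))"
    using assms by (intro sum.cong) (auto intro!: ramanujan_c_prime_quotient div_gcd_eq_of_cofactor_dvd)
  also have "\<dots> = - ((\<Sum>m | m dvd n \<and> \<not> m dvd n div p. real (totient m)) / (real p - 1))"
    by (simp add: sum_negf sum_divide_distrib)
  also have "(\<Sum>m | m dvd n \<and> \<not> m dvd n div p. real (totient m)) = real n - real (n div p)"
  proof -
    have "{m. m dvd n \<and> \<not> m dvd n div p} = {m. m dvd n} - {m. m dvd n div p}" by auto
    moreover have "n div p dvd n"
      using assms(2) by (metis dvd_div_mult_self dvd_triv_left)
    then have "{m. m dvd n div p} \<subseteq> {m. m dvd n}" by (auto intro: dvd_trans)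
    ultimately have "(\<Sum>m | m dvd n \<and> \<not> m dvd n div p. real (totient m))
      = (\<Sum>m | m dvd n. real (totient m)) - (\<Sum>m | m dvd n div p. real (totient m))"
      using assms(3) by (simp add: sum_diff)
    then show ?thesis by (metis of_nat_sum totient_divisor_sum)
  qed
  also have "(real n - real (n div p)) / (real p - 1) = real n / real p"
    using p1 assms(2) by (simp add: real_of_nat_div field_simps)
  finally show ?thesis .
qed

text \<open>The difference to the minimum is a sum of absolute values of terms over the symmetric difference
  of the two sets, which is nonempty.  Each of these is large enough.  An added term is
  \<open>totient m\<close> with \<open>m \<noteq> 1\<close>, and \<open>m\<close> has a prime factor not less than \<open>p\<close>.  An omitted one is
  \<open>totient m / (p - 1)\<close> in absolute value, where \<open>m\<close> is divisible by \<open>p\<close>, and even by \<open>p\<^sup>2\<close> if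
  \<open>p\<^sup>2 dvd n\<close>.\<close>

lemma ICG_eigenvalue_ge_of_cofactor_dvd:
  assumes p: "prime p" "p dvd n" "\<And>q. prime q \<Longrightarrow> q dvd n \<Longrightarrow> p \<le> q" and n: "n > 0"
    and j: "n div p dvd j" "\<not> n dvd j"
    and D: "D \<subseteq> proper_divisors n" "D \<noteq> proper_divisors_avoiding n p"
  shows "ICG_eigenvalue n D j \<ge> - (real n / real p) + (if p\<^sup>2 dvd n then real p - 1 else 1)"
proof -
  let ?E = "proper_divisors_avoiding n p"
  let ?f = "\<lambda>d. ramanujan_c j (n div d)"
  let ?\<delta> = "if p\<^sup>2 dvd n then real p - 1 else 1"
  have p1: "p > 1" using p(1) by (rule prime_gt_1_nat)
  have fin: "finite D" "finite ?E"
    using D(1) by (auto simp: proper_divisors_avoiding_def proper_divisors_def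
        intro!: finite_subset[of D "{..n}"])
  have E: "?E = {d. d dvd n \<and> \<not> n div d dvd n div p}"
    using proper_divisors_avoiding_eq p(1,2) n .
  have add: "?\<delta> \<le> ?f d" if "d \<in> D - ?E" for d
  proof -
    have d: "d dvd n" "d < n" "n div d dvd n div p"
      using that D(1) E by (auto simp: proper_divisors_def)
    have m: "n div d dvd n" "n div d > 0" "n div d \<noteq> 1"
      using d n by (auto elim!: dvdE)
    obtain q where q: "prime q" "q dvd n div d" using prime_factor_nat[OF m(3)] by blast
    have "p \<le> q" using p(3)[OF q(1) dvd_trans[OF q(2) m(1)]] .
    moreover have "q - 1 \<le> totient (n div d)"
      using totient_dvd_mono[OF q(2)] q(1) m(2) by (simp add: totient_prime dvd_imp_le)
    ultimately have "real p - 1 \<le> totient (n div d)" using p1 by linarith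
    moreover have "?f d = totient (n div d)"
      using d(3) j(1) m(2) by (meson dvd_trans ramanujan_c_dvd)
    ultimately show ?thesis using p1 by auto
  qed
  have remove: "?\<delta> \<le> - ?f d" if "d \<in> ?E - D" for d
  proof -
    define m where "m = n div d"
    have d: "d dvd n" "\<not> m dvd n div p" using that E by (auto simp: m_def)
    have m: "m dvd n" "m > 0"
      using d(1) n by (auto simp: m_def elim!: dvdE)
    have quot: "m div gcd m j = p"
      using div_gcd_eq_of_cofactor_dvd[OF p(1,2) n j m(1) d(2)] .
    then have f: "- ?f d = totient m / (real p - 1)"
      using ramanujan_c_prime_quotient[OF p(1)] by (simp add: m_def)
    have mg: "m = p * gcd m j" using quot by (metis dvd_mult_div_cancel gcd_dvd1 mult.commute)
    show ?thesis
    proof (cases "p\<^sup>2 dvd n")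
      case True
      have "p dvd n div p" using True p1 by (auto simp: power2_eq_square elim!: dvdE)
      then have "p dvd gcd m j" using mg j(1) by (metis dvd_trans dvd_triv_left gcd_greatest)
      then have "p\<^sup>2 dvd m" using mg by (metis dvd_refl mult_dvd_mono power2_eq_square)
      then have "p * (p - 1) \<le> totient m"
        using totient_dvd_mono[of "p\<^sup>2" m] m(2) p(1)
        by (simp add: dvd_imp_le totient_prime_power)
      then have "real (p * (p - 1)) \<le> real (totient m)" by (simp only: of_nat_le_iff)
      then have "real p \<le> - ?f d"
        unfolding f using p1 by (simp add: field_simps of_nat_diff)
      with True show ?thesis by simp
    next
      case False
      have "p - 1 \<le> totient m"
        using totient_dvd_mono[of p m] m(2) p(1) mg
        by (metis dvd_imp_le dvd_triv_left totient_gt_0_iff totient_prime)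
      then have "real p - 1 \<le> real (totient m)" by linarith
      with False show ?thesis unfolding f using p1 by simp
    qed
  qed
  have "?\<delta> > 0" using p1 by simp
  \<comment> \<open>The divisors common to both sets cancel.\<close>
  have split: "ICG_eigenvalue n D j - ICG_eigenvalue n ?E j
      = (\<Sum>d\<in>D - ?E. ?f d) + (\<Sum>d\<in>?E - D. - ?f d)"
    unfolding ICG_eigenvalue_def using fin
    by (simp add: sum_negf sum.Int_Diff[of D ?f ?E] sum.Int_Diff[of ?E ?f D] Int_commute)
  have pos: "(\<Sum>d\<in>A. g d) \<ge> 0" "A \<noteq> {} \<Longrightarrow> ?\<delta> \<le> (\<Sum>d\<in>A. g d)"
    if "\<And>d. d \<in> A \<Longrightarrow> ?\<delta> \<le> g d" "finite A" for A and g :: "nat \<Rightarrow> real"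
  proof -
    have nonneg: "g d \<ge> 0" if "d \<in> A" for d
      using that \<open>\<And>d. d \<in> A \<Longrightarrow> ?\<delta> \<le> g d\<close>[of d] \<open>?\<delta> > 0\<close> by linarith
    then show "(\<Sum>d\<in>A. g d) \<ge> 0" by (rule sum_nonneg)
    assume "A \<noteq> {}"
    then obtain a where "a \<in> A" by blast
    then show "?\<delta> \<le> (\<Sum>d\<in>A. g d)"
      using member_le_sum[of a A g] nonneg that by force
  qed
  have "D - ?E \<noteq> {} \<or> ?E - D \<noteq> {}" using D(2) by blast
  then have "?\<delta> \<le> (\<Sum>d\<in>D - ?E. ?f d) + (\<Sum>d\<in>?E - D. - ?f d)"
    using pos[of "D - ?E" ?f, OF add] pos[of "?E - D" "\<lambda>d. - ?f d", OF remove] fin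
    by (smt (verit) finite_Diff)
  then show ?thesis
    using split ICG_eigenvalue_avoiding[OF p(1,2) n j] by linarith
qed

section \<open>The bound and the cases of equality\<close>

lemma ICG_eigenvalue_ge:
  assumes p: "prime p" "p dvd n" "\<And>q. prime q \<Longrightarrow> q dvd n \<Longrightarrow> p \<le> q" and n: "n > 0"
    and D: "D \<subseteq> proper_divisors n" "D \<noteq> proper_divisors_avoiding n p"
  shows "ICG_eigenvalue n D j \<ge> - (real n / real p) + (if p\<^sup>2 dvd n then real p - 1 else 1)"
proof -
  consider "n dvd j" | "\<not> n dvd j" "n div p dvd j" | "\<not> n dvd j" "\<not> n div p dvd j" by blast
  then show ?thesis
  proof cases
    case 1
    have "p \<le> n" using p(2) n by (rule dvd_imp_le)
    have "real p \<le> real n / real p" if "p\<^sup>2 dvd n"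
    proof -
      have "real (p\<^sup>2) \<le> real n" using that n by (simp only: of_nat_le_iff dvd_imp_le)
      then show ?thesis using prime_gt_0_nat[OF p(1)] by (simp add: field_simps power2_eq_square)
    qed
    moreover have "1 \<le> real n / real p"
      using \<open>p \<le> n\<close> prime_gt_0_nat[OF p(1)] by simp
    moreover have "ICG_eigenvalue n D j \<ge> 0"
      unfolding ICG_eigenvalue_def
    proof (intro sum_nonneg)
      fix d assume "d \<in> D"
      then have "d dvd n" using D(1) by (auto simp: proper_divisors_def)
      then have "n div d dvd j" "n div d > 0" using 1 n by (auto elim!: dvdE)
      then show "ramanujan_c j (n div d) \<ge> 0" by (simp add: ramanujan_c_dvd)
    qed
    ultimately show ?thesis by auto
  next
    case 2
    then show ?thesis using ICG_eigenvalue_ge_of_cofactor_dvd p n D by blast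
  next
    case 3
    then show ?thesis
      using half_sum_abs_ramanujan_c_le[OF p n 3] ICG_eigenvalue_ge_sum_abs[OF n 3(1) D(1)]
      by linarith
  qed
qed

text \<open>The divisor \<open>n div p\<close> has the codivisor \<open>p\<close>, which divides \<open>n div p\<close> and hence \<open>j\<close>.\<close>

lemma ICG_eigenvalue_avoiding_insert:
  assumes "prime p" "n > 0" "n div p dvd j" "\<not> n dvd j" "p\<^sup>2 dvd n"
  shows "ICG_eigenvalue n (proper_divisors_avoiding n p \<union> {n div p}) j
    = - (real n / real p) + real p - 1"
proof -
  have p1: "p > 1" using assms(1) by (rule prime_gt_1_nat)
  have pn: "p dvd n" using assms(5) by (metis dvd_mult_left power2_eq_square)
  have pr: "p dvd n div p" using assms(5) p1 by (auto simp: power2_eq_square elim!: dvdE)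
  have nd: "n div (n div p) = p" using pn assms(2) by (auto elim!: dvdE)
  have "ramanujan_c j p = real p - 1"
    using pr assms(1,3) p1 ramanujan_c_dvd[of p j] dvd_trans[of p "n div p" j]
    by (simp add: totient_prime of_nat_diff)
  moreover have "n div p \<notin> proper_divisors_avoiding n p"
    using pr by (simp add: proper_divisors_avoiding_def)
  moreover have "finite (proper_divisors_avoiding n p)"
    by (auto simp: proper_divisors_avoiding_def proper_divisors_def)
  ultimately show ?thesis
    using ICG_eigenvalue_avoiding[OF assms(1) pn assms(2-4)] nd
    by (simp add: ICG_eigenvalue_def)
qed

text \<open>The codivisor \<open>p\<close> of \<open>n div p\<close> does not divide \<open>n div p\<close>, so its Ramanujan sum is
  \<open>- totient p / (p - 1) = - 1\<close>.\<close>

lemma ICG_eigenvalue_avoiding_remove: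
  assumes "prime p" "p dvd n" "n > 0" "n div p dvd j" "\<not> n dvd j" "\<not> p\<^sup>2 dvd n"
  shows "ICG_eigenvalue n (proper_divisors_avoiding n p - {n div p}) j
    = - (real n / real p) + 1"
proof -
  have p1: "p > 1" using assms(1) by (rule prime_gt_1_nat)
  have nd: "n div (n div p) = p" using assms(2,3) by (auto elim!: dvdE)
  have "\<not> p dvd n div p"
    using assms(2,6) p1 by (auto simp: power2_eq_square elim!: dvdE)
  then have "n div p \<in> proper_divisors_avoiding n p" and c: "ramanujan_c j p = - 1"
  proof -
    assume *: "\<not> p dvd n div p"
    then show "n div p \<in> proper_divisors_avoiding n p"
      using nd assms by (auto simp: proper_divisors_avoiding_eq div_dvd_iff_mult)
    show "ramanujan_c j p = - 1"
      using ramanujan_c_prime_quotient[OF assms(1), of p j]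
        div_gcd_eq_of_cofactor_dvd[OF assms(1-5) assms(2) *] p1 assms(1)
      by (simp add: totient_prime of_nat_diff)
  qed
  moreover have "finite (proper_divisors_avoiding n p)"
    by (auto simp: proper_divisors_avoiding_def proper_divisors_def)
  ultimately show ?thesis
    using ICG_eigenvalue_avoiding[OF assms(1-5)] nd
    by (simp add: ICG_eigenvalue_def sum_diff1)
qed

text \<open>All that the argument uses of the factorization; the case distinction on the exponent of the
  least prime becomes one on divisibility by its square.\<close>

lemma smallest_prime_of_factorization:
  fixes p \<alpha> :: "nat \<Rightarrow> nat"
  assumes prime: "\<And>i. i \<in> {1..k} \<Longrightarrow> prime (p i)"
    and pos: "\<And>i. i \<in> {1..k} \<Longrightarrow> \<alpha> i \<ge> 1"
    and mono: "strict_mono_on {1..k} p"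
    and n: "n = (\<Prod>i\<in>{1..k}. p i ^ \<alpha> i)" "n > 1"
  shows "prime (p 1)" "p 1 dvd n" "\<And>q. prime q \<Longrightarrow> q dvd n \<Longrightarrow> p 1 \<le> q"
    "(p 1)\<^sup>2 dvd n \<longleftrightarrow> \<alpha> 1 > 1"
proof -
  have k: "1 \<in> {1..k}" using n by (cases k) auto
  show p1: "prime (p 1)" using prime k by blast
  have a: "\<alpha> 1 \<ge> 1" using pos k by blast
  define m where "m = (\<Prod>i\<in>{1..k} - {1}. p i ^ \<alpha> i)"
  have nm: "n = p 1 ^ \<alpha> 1 * m"
    unfolding n m_def using k by (subst prod.remove[of _ 1]) auto
  then show "p 1 dvd n" using a by (metis dvd_mult2 dvd_power not_one_le_zero gr0I)
  have dvd: "\<exists>i\<in>A. q = p i"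
    if q: "prime q" "q dvd (\<Prod>i\<in>A. p i ^ \<alpha> i)" and A: "A \<subseteq> {1..k}" for q A
  proof -
    have "finite A" using A by (rule finite_subset) simp
    then obtain i where i: "i \<in> A" "q dvd p i ^ \<alpha> i"
      using q by (auto simp: prime_dvd_prod_iff)
    then have "q dvd p i" using q(1) prime_dvd_power by blast
    moreover have "prime (p i)" using prime i(1) A by blast
    ultimately show ?thesis using q(1) i(1) primes_dvd_imp_eq by blast
  qed
  show "p 1 \<le> q" if q: "prime q" "q dvd n" for q
  proof -
    obtain i where "i \<in> {1..k}" "q = p i" using dvd[of q "{1..k}"] q n(1) by blast
    then show ?thesis using mono k by (metis atLeastAtMost_iff strict_mono_on_leD)
  qed
  have "\<not> p 1 dvd m"
  proof
    assume "p 1 dvd m"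
    then obtain i where "i \<in> {1..k} - {1}" "p 1 = p i"
      using dvd[of "p 1" "{1..k} - {1}"] p1 unfolding m_def by blast
    then show False using mono k by (metis DiffE insertI1 strict_mono_on_eqD)
  qed
  then have "\<not> (p 1)\<^sup>2 dvd p 1 * m"
    using p1 by (simp add: power2_eq_square prime_gt_0_nat)
  then show "(p 1)\<^sup>2 dvd n \<longleftrightarrow> \<alpha> 1 > 1"
    using a nm by (cases "\<alpha> 1 = 1") (auto intro!: dvd_mult2 le_imp_power_dvd)
qed

theorem theorem5:
  fixes n k :: nat and p \<alpha> :: "nat \<Rightarrow> nat" and D :: "nat set"
  assumes "n > 1" and "\<not> prime n"
    and "\<And>i. i \<in> {1..k} \<Longrightarrow> prime (p i)"
    and "\<And>i. i \<in> {1..k} \<Longrightarrow> \<alpha> i \<ge> 1"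
    and "strict_mono_on {1..k} p"
    and "n = (\<Prod>i\<in>{1..k}. p i ^ \<alpha> i)"
    and "D \<subseteq> proper_divisors n"
    and "D \<noteq> proper_divisors_avoiding n (p 1)"
    and "ICG_connected n D"
  shows
    "(\<forall>j\<in>{1..n}. ICG_eigenvalue n D j \<ge>
        (if \<alpha> 1 > 1 then - (real n / real (p 1)) + real (p 1) - 1
         else - (real n / real (p 1)) + 1))
     \<and> (\<forall>j\<in>{1..n - 1}.
          \<alpha> 1 > 1 \<and> D = proper_divisors_avoiding n (p 1) \<union> {n div p 1} \<and> n div p 1 dvd j
          \<longrightarrow> ICG_eigenvalue n D j = - (real n / real (p 1)) + real (p 1) - 1)
     \<and> (\<forall>j\<in>{1..n - 1}.
          \<alpha> 1 = 1 \<and> D = proper_divisors_avoiding n (p 1) - {n div p 1} \<and> n div p 1 dvd j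
          \<longrightarrow> ICG_eigenvalue n D j = - (real n / real (p 1)) + 1)
     \<and> (\<forall>j. n = 6 \<and> (D = {1} \<and> j = 3 \<or> D = {1, 2} \<and> j \<in> {2, 4} \<or> D = {2, 3} \<and> j \<in> {1, 5})
          \<longrightarrow> ICG_eigenvalue n D j = - (real n / real (p 1)) + 1)"
proof -
  note P = smallest_prime_of_factorization[OF assms(3-6,1)]
  have n0: "n > 0" using assms(1) by simp
  have nd: "\<not> n dvd j" if "j \<in> {1..n - 1}" for j
    using that n0 by (auto dest: dvd_imp_le)
  have bound: "ICG_eigenvalue n D j \<ge> (if \<alpha> 1 > 1 then - (real n / real (p 1)) + real (p 1) - 1
         else - (real n / real (p 1)) + 1)" for j
    using ICG_eigenvalue_ge[OF P(1-3) n0 assms(7,8), of j] P(4) by auto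
  have six: "ICG_eigenvalue n D j = - (real n / real (p 1)) + 1"
    if n: "n = 6" and D: "D = {1} \<and> j = 3 \<or> D = {1, 2} \<and> j \<in> {2, 4} \<or> D = {2, 3} \<and> j \<in> {1, 5}" for j
  proof -
    have "p 1 = 2" using P(1) P(3)[of 2] n prime_ge_2_nat[of "p 1"] by simp
    have "gcd 6 (4::nat) = 2" "gcd 3 (4::nat) = 1" "gcd 3 (2::nat) = 1" "gcd 3 (5::nat) = 1"
      "gcd 2 (5::nat) = 1" "gcd 6 (3::nat) = 3" "gcd 6 (2::nat) = 2"
      by (simp_all add: gcd_non_0_nat)
    moreover have "totient 3 = 2" by (simp add: totient_prime)
    ultimately have "ramanujan_c 3 6 = - 2" "ramanujan_c 2 6 = - 1" "ramanujan_c 2 3 = - 1"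
      "ramanujan_c 4 6 = - 1" "ramanujan_c 4 3 = - 1" "ramanujan_c 1 3 = - 1" "ramanujan_c 1 2 = - 1"
      "ramanujan_c 5 3 = - 1" "ramanujan_c 5 2 = - 1"
      by (simp_all add: ramanujan_c_def moebius_prime)
    with D show ?thesis
      unfolding n \<open>p 1 = 2\<close> by (auto simp: ICG_eigenvalue_def)
  qed
  have "ICG_eigenvalue n (proper_divisors_avoiding n (p 1) \<union> {n div p 1}) j
      = - (real n / real (p 1)) + real (p 1) - 1"
    if "j \<in> {1..n - 1}" "\<alpha> 1 > 1" "n div p 1 dvd j" for j
    using ICG_eigenvalue_avoiding_insert[OF P(1) n0 that(3) nd[OF that(1)]] P(4) that by blast
  moreover have "ICG_eigenvalue n (proper_divisors_avoiding n (p 1) - {n div p 1}) j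
      = - (real n / real (p 1)) + 1"
    if "j \<in> {1..n - 1}" "\<alpha> 1 = 1" "n div p 1 dvd j" for j
    using ICG_eigenvalue_avoiding_remove[OF P(1,2) n0 that(3) nd[OF that(1)]] P(4) that by simp
  ultimately show ?thesis
    using bound six by blast
qed

end
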